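(* For $c>0$ let $v_1=(0,0)$, $v_2=(c^{-1},1)$, $v_3=(0,1)$ in $\mathbb{R}^2$, $\Theta_L=\operatorname{conv}(v_1,v_2,v_3)$, $\Theta_S=\operatorname{conv}(v_1,v_2)$, and $\theta^\star=v_1$. Consider the radial location model $Y=\theta^\star+\sigma W_q$ in $\mathbb{R}^2$ with $q$ admissible, and evaluate risk using $R_\sigma^{(q,\eta)}$. For each admissible $q$ and each of the constraint sets $\Theta\in\{\Theta_S,\Theta_L\}$, the constrained maximum likelihood estimator and the constrained least squares estimator over $\Theta$ coincide, and both are equal to the Euclidean projection of the observation onto $\Theta$. Moreover, for every $\eta>1$ there exists $c_\eta>0$ such that the following holds: for every admissible $q$ and every $0<c<c_\eta$, there exists $\sigma_1<\infty$ such that $$R_\sigma^{(q,\eta)}(\theta^\star;\Theta_S)>R_\sigma^{(q,\eta)}(\theta^\star;\Theta_L)\qquad\text{for all }\sigma\ge\sigma_1.$$ If $\eta\ge2$, then the same conclusion holds for every $0<c<1$ (that is, for every admissible $q$ and every $0<c<1$ there exists $\sigma_1<\infty$ such that the displayed inequality holds for all $\sigma\ge\sigma_1$).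
   Context: Work in dimension $d=2$. A function $q:[0,\infty)\to(0,\infty)$ is called admissible if it is strictly decreasing and $0<C_q:=\int_{\mathbb{R}^d}q(\|w\|)\,dw<\infty$. For admissible $q$, $W_q$ is an $\mathbb{R}^d$-valued random vector with density $f_q(w)=C_q^{-1}q(\|w\|)$, and for $\sigma>0$ the observation is $Y=\theta+\sigma W_q$. For a nonempty compact convex set $\Theta$, $\Pi_\Theta(y)=\arg\min_{\theta\in\Theta}\|y-\theta\|^2$ is the Euclidean projection. Given an observation $y\in\mathbb{R}^d$, the constrained maximum likelihood estimator over $\Theta$ is the maximizer over $\theta\in\Theta$ of the likelihood, which is proportional to $q(\|y-\theta\|/\sigma)$; the constrained least squares estimator over $\Theta$ is the minimizer of $\|y-\theta\|^2$ over $\theta\in\Theta$. The radial risk, for $\eta>0$ and $\theta\in\Theta$, is $R_\sigma^{(q,\eta)}(\theta;\Theta)=\mathbb{E}\,\frac1\eta\|\Pi_\Theta(\theta+\sigma W_q)-\theta\|^\eta$. *)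

theory Defs
  imports "HOL-Probability.Probability"
begin

text \<open>The radial profile \<open>q\<close> is only ever evaluated at norms, so its values at negative
  arguments are irrelevant; monotonicity and positivity are required on \<open>[0,\<infinity>)\<close> only.
  Since the Bochner integral of a non-integrable function is \<open>0\<close>, finiteness of the normalizing
  constant is expressed by integrability.\<close>

definition normalizer :: "(real \<Rightarrow> real) \<Rightarrow> real" where
  "normalizer q = (\<integral>w. q (norm w) \<partial>(lborel :: (real^2) measure))"

definition admissible :: "(real \<Rightarrow> real) \<Rightarrow> bool" where
  "admissible q \<longleftrightarrow>
     (\<forall>r\<ge>0. 0 < q r) \<and>
     strict_antimono_on {0..} q \<and>
     integrable (lborel :: (real^2) measure) (\<lambda>w. q (norm w)) \<and>
     0 < normalizer q"

definition noise_density :: "(real \<Rightarrow> real) \<Rightarrow> real^2 \<Rightarrow> real" where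
  "noise_density q w = q (norm w) / normalizer q"

definition noise_law :: "(real \<Rightarrow> real) \<Rightarrow> (real^2) measure" where
  "noise_law q = density lborel (\<lambda>w. ennreal (noise_density q w))"

lemma prob_space_noise_law:
  assumes "admissible q"
  shows "prob_space (noise_law q)"
proof
  have int: "integrable lborel (\<lambda>w::real^2. noise_density q w)"
    using assms unfolding admissible_def noise_density_def by simp
  have nonneg: "0 \<le> noise_density q w" for w
    using assms unfolding admissible_def noise_density_def by (simp add: less_imp_le)
  have "(\<integral>w. noise_density q w \<partial>lborel) = 1"
    using assms unfolding noise_density_def admissible_def
    by (simp add: normalizer_def)
  then have "(\<integral>\<^sup>+w. ennreal (noise_density q w) \<partial>lborel) = 1"
    using int nonneg by (simp add: nn_integral_eq_integral)
  moreover have "(\<lambda>w. ennreal (noise_density q w)) \<in> borel_measurable lborel"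
    using int by measurable
  ultimately show "emeasure (noise_law q) (space (noise_law q)) = 1"
    by (simp add: noise_law_def emeasure_density)
qed

text \<open>The likelihood of \<open>\<theta>\<close> at the observation \<open>y\<close> is the Lebesgue density at \<open>y\<close> of
  \<open>Y = \<theta> + \<sigma> W\<close> with \<open>W\<close> distributed according to \<open>noise_law q\<close>; the factor \<open>\<sigma>\<^sup>2\<close> is the
  Jacobian determinant of \<open>w \<mapsto> \<sigma> w\<close> in the plane.\<close>

definition likelihood :: "(real \<Rightarrow> real) \<Rightarrow> real \<Rightarrow> real^2 \<Rightarrow> real^2 \<Rightarrow> real" where
  "likelihood q \<sigma> y \<theta> = noise_density q ((y - \<theta>) /\<^sub>R \<sigma>) / \<sigma>\<^sup>2"

lemma distr_observation:
  assumes "admissible q" "0 < \<sigma>"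
  shows "distr (noise_law q) lborel (\<lambda>w. \<theta> + \<sigma> *\<^sub>R w) =
    density lborel (\<lambda>y. ennreal (likelihood q \<sigma> y \<theta>))"
proof (rule measure_eqI)
  have int: "integrable lborel (\<lambda>w::real^2. noise_density q w)"
    using assms unfolding admissible_def noise_density_def by simp
  have [measurable]: "noise_density q \<in> borel_measurable borel"
    using borel_measurable_integrable[OF int] by simp
  have nonneg: "0 \<le> noise_density q w" for w
    using assms unfolding admissible_def noise_density_def by (simp add: less_imp_le)
  have lik [measurable]: "(\<lambda>y. likelihood q \<sigma> y \<theta>) \<in> borel_measurable borel"
    unfolding likelihood_def by measurable
  fix A assume "A \<in> sets (distr (noise_law q) lborel (\<lambda>w. \<theta> + \<sigma> *\<^sub>R w))"
  then have A [measurable]: "A \<in> sets borel" by simp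
  have aff: "(lborel :: (real^2) measure) =
      density (distr lborel borel (\<lambda>w. \<theta> + \<sigma> *\<^sub>R w)) (\<lambda>_. ennreal (\<sigma>\<^sup>2))"
    using lborel_affine[of \<sigma> \<theta>] assms(2) by simp
  have pre [measurable]: "(\<lambda>w. \<theta> + \<sigma> *\<^sub>R w) -` A \<in> sets borel"
    using measurable_sets_borel[of "\<lambda>w. \<theta> + \<sigma> *\<^sub>R w" borel A] A by simp
  have "emeasure (density lborel (\<lambda>y. ennreal (likelihood q \<sigma> y \<theta>))) A
      = (\<integral>\<^sup>+y. ennreal (likelihood q \<sigma> y \<theta>) * indicator A y \<partial>lborel)"
    by (simp add: emeasure_density)
  also have "\<dots> = (\<integral>\<^sup>+w. ennreal (\<sigma>\<^sup>2) *
      (ennreal (likelihood q \<sigma> (\<theta> + \<sigma> *\<^sub>R w) \<theta>) * indicator A (\<theta> + \<sigma> *\<^sub>R w)) \<partial>lborel)"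
    by (subst aff) (simp add: nn_integral_density nn_integral_distr)
  also have "\<dots> = (\<integral>\<^sup>+w. ennreal (noise_density q w) * indicator ((\<lambda>w. \<theta> + \<sigma> *\<^sub>R w) -` A) w \<partial>lborel)"
    using assms(2) nonneg
    by (intro nn_integral_cong)
      (auto simp: likelihood_def indicator_def ennreal_mult[symmetric])
  also have "\<dots> = emeasure (noise_law q) ((\<lambda>w. \<theta> + \<sigma> *\<^sub>R w) -` A)"
    unfolding noise_law_def by (subst emeasure_density) auto
  also have "\<dots> = emeasure (distr (noise_law q) lborel (\<lambda>w. \<theta> + \<sigma> *\<^sub>R w)) A"
    by (subst emeasure_distr) (auto simp: noise_law_def)
  finally show "emeasure (distr (noise_law q) lborel (\<lambda>w. \<theta> + \<sigma> *\<^sub>R w)) A =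
    emeasure (density lborel (\<lambda>y. ennreal (likelihood q \<sigma> y \<theta>))) A" ..
qed simp

definition is_constrained_mle ::
    "(real \<Rightarrow> real) \<Rightarrow> real \<Rightarrow> (real^2) set \<Rightarrow> real^2 \<Rightarrow> real^2 \<Rightarrow> bool" where
  "is_constrained_mle q \<sigma> \<Theta> y = is_arg_max (likelihood q \<sigma> y) (\<lambda>\<theta>. \<theta> \<in> \<Theta>)"

definition is_constrained_lse :: "(real^2) set \<Rightarrow> real^2 \<Rightarrow> real^2 \<Rightarrow> bool" where
  "is_constrained_lse \<Theta> y = is_arg_min (\<lambda>\<theta>. (norm (y - \<theta>))\<^sup>2) (\<lambda>\<theta>. \<theta> \<in> \<Theta>)"

text \<open>The Euclidean projection onto \<open>\<Theta>\<close> is the library's \<^const>\<open>closest_point\<close>. For \<open>\<eta> > 0\<close> the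
  convention \<open>0 powr \<eta> = 0\<close> gives the intended value when the error vanishes.\<close>

definition radial_risk ::
    "(real \<Rightarrow> real) \<Rightarrow> real \<Rightarrow> real \<Rightarrow> real^2 \<Rightarrow> (real^2) set \<Rightarrow> real" where
  "radial_risk q \<eta> \<sigma> \<theta> \<Theta> =
     (\<integral>w. (1 / \<eta>) * norm (closest_point \<Theta> (\<theta> + \<sigma> *\<^sub>R w) - \<theta>) powr \<eta> \<partial>(noise_law q))"

definition vtx1 :: "real^2" where "vtx1 = vector [0, 0]"
definition vtx2 :: "real \<Rightarrow> real^2" where "vtx2 c = vector [1 / c, 1]"
definition vtx3 :: "real^2" where "vtx3 = vector [0, 1]"

definition Theta_S :: "real \<Rightarrow> (real^2) set" where
  "Theta_S c = convex hull {vtx1, vtx2 c}"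

definition Theta_L :: "real \<Rightarrow> (real^2) set" where
  "Theta_L c = convex hull {vtx1, vtx2 c, vtx3}"

end

theory Submission
  imports Defs
begin

text \<open>
  Every admissible profile is strictly decreasing, so maximising the likelihood over a set means
  minimising the distance to the observation. On a compact convex set the minimiser is unique,
  and this gives the coincidence of both estimators with the projection.

  For the risk comparison write the observation as \<open>\<sigma> w\<close>, with true parameter \<open>0\<close>. For almost
  every \<open>w\<close> and all large \<open>\<sigma>\<close>, the projection of \<open>\<sigma> w\<close> onto a polytope is the vertex at which \<open>w\<close>, as a linear
  functional, is maximal (\<open>closest_point_hull_eventually_vertex\<close>), so by dominated
  convergence the risks converge. Adding the vertex \<open>v\<^sub>3\<close>, of norm \<open>1\<close>, to the segment changes the
  limit only for directions in the open quadrant \<open>w\<^sub>1 < 0 < w\<^sub>2\<close>. All of these now project to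
  \<open>v\<^sub>3\<close>, at the cost of an error \<open>1\<close> on a right angle. Those among them that formerly projected to
  \<open>v\<^sub>2\<close> are the directions between the vertical axis and the normal of the segment, a sector of angle
  \<open>\<phi> = arctan c\<close>, and there an error of norm \<open>1 / sin \<phi>\<close> is removed. Since the noise is isotropic,
  the probabilities of sectors are proportional to their angles (\<open>sector_probability\<close>), and the
  segment is asymptotically worse when \<open>\<phi> / (sin \<phi>)\<^sup>\<eta> > \<pi> / 2\<close>.

  If \<open>\<eta> > 1\<close>, then \<open>\<phi> \<ge> sin \<phi>\<close> bounds the left side below by \<open>(sin \<phi>)\<close> to the power
  \<open>1 - \<eta>\<close>, which exceeds \<open>\<pi> / 2\<close> for small \<open>c\<close>. If \<open>\<eta> \<ge> 2\<close>, it suffices to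
  treat \<open>\<eta> = 2\<close>: the claim is \<open>1 - cos (2\<phi>) < 4\<phi> / \<pi>\<close>, which is strict concavity of the cosine on
  \<open>[0, \<pi>/2]\<close>. Equality holds at \<open>\<phi> = \<pi> / 4\<close>, which is where the bound \<open>c < 1\<close> comes from.
\<close>

section \<open>Likelihood, least squares and projection\<close>

lemma admissible_normalizer_pos: "admissible q \<Longrightarrow> 0 < normalizer q"
  by (simp add: admissible_def)

lemma closest_point_iff_minimal:
  fixes \<Theta> :: "'a::euclidean_space set"
  assumes "compact \<Theta>" "convex \<Theta>" "\<Theta> \<noteq> {}"
  shows "\<theta> = closest_point \<Theta> y \<longleftrightarrow> \<theta> \<in> \<Theta> \<and> (\<forall>\<theta>'\<in>\<Theta>. norm (y - \<theta>) \<le> norm (y - \<theta>'))"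
proof -
  have "closed \<Theta>" using assms by (simp add: compact_imp_closed)
  then show ?thesis
    using closest_point_exists[of \<Theta> y] closest_point_unique[of \<Theta> \<theta> y] assms by (auto simp: dist_norm)
qed

lemma likelihood_less_iff:
  assumes "admissible q" "0 < \<sigma>"
  shows "likelihood q \<sigma> y \<theta> < likelihood q \<sigma> y \<theta>' \<longleftrightarrow> norm (y - \<theta>') < norm (y - \<theta>)"
proof -
  have anti: "q b < q a \<longleftrightarrow> a < b" if "0 \<le> a" "0 \<le> b" for a b
    using assms(1) that unfolding admissible_def monotone_on_def
    by (metis atLeast_iff linorder_less_linear order_less_asym)
  have "0 < normalizer q" "\<not> normalizer q * \<sigma>\<^sup>2 < 0"
    using admissible_normalizer_pos[OF assms(1)] by (auto simp: mult_less_0_iff)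
  then show ?thesis
    using assms(2)
    by (simp add: likelihood_def noise_density_def divide_less_cancel anti)
qed

lemma mle_iff_projection:
  assumes "compact \<Theta>" "convex \<Theta>" "\<Theta> \<noteq> {}" "admissible q" "0 < \<sigma>"
  shows "is_constrained_mle q \<sigma> \<Theta> y \<theta> \<longleftrightarrow> \<theta> = closest_point \<Theta> y"
  unfolding closest_point_iff_minimal[OF assms(1-3)] is_constrained_mle_def is_arg_max_def
    likelihood_less_iff[OF assms(4,5)]
  by (auto simp: not_less)

lemma lse_iff_projection:
  assumes "compact \<Theta>" "convex \<Theta>" "\<Theta> \<noteq> {}"
  shows "is_constrained_lse \<Theta> y \<theta> \<longleftrightarrow> \<theta> = closest_point \<Theta> y"
  unfolding closest_point_iff_minimal[OF assms] is_constrained_lse_def is_arg_min_def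
  by (auto simp: not_less)

lemma constraint_sets:
  assumes "\<Theta> \<in> {Theta_S c, Theta_L c}"
  shows "compact \<Theta>" "convex \<Theta>" "\<Theta> \<noteq> {}"
proof -
  obtain V where "\<Theta> = convex hull V" "finite V" "V \<noteq> {}"
    using assms unfolding Theta_S_def Theta_L_def by blast
  then show "compact \<Theta>" "convex \<Theta>" "\<Theta> \<noteq> {}"
    by (auto simp: finite_imp_compact_convex_hull)
qed

lemma vtx1_zero: "vtx1 = 0"
  by (simp add: vtx1_def vec_eq_iff forall_2)

section \<open>Projection of distant points onto a polytope\<close>

text \<open>The point \<open>\<sigma> w\<close> projects to \<open>v\<close> as soon as \<open>\<sigma> w - v\<close> lies in the normal cone of the hull at
  \<open>v\<close>. It suffices to test this against the other vertices \<open>u\<close>, where it reads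
  \<open>\<sigma> (w \<bullet> (v - u)) \<ge> v \<bullet> (v - u)\<close>; strict maximality makes the factor of \<open>\<sigma>\<close> positive.\<close>

lemma closest_point_hull_eventually_vertex:
  fixes V :: "'a::euclidean_space set"
  assumes "finite V" "v \<in> V" and max: "\<And>u. u \<in> V \<Longrightarrow> u \<noteq> v \<Longrightarrow> w \<bullet> u < w \<bullet> v"
  shows "\<forall>\<^sub>F \<sigma> in at_top. closest_point (convex hull V) (\<sigma> *\<^sub>R w) = v"
proof -
  have "\<forall>\<^sub>F \<sigma> in at_top. (\<sigma> *\<^sub>R w - v) \<bullet> (u - v) \<le> 0" if "u \<in> V" for u
  proof (cases "u = v")
    case False
    then have pos: "0 < w \<bullet> v - w \<bullet> u" using max that by simp
    show ?thesis
      using eventually_ge_at_top[of "- (v \<bullet> (u - v)) / (w \<bullet> v - w \<bullet> u)"]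
    proof eventually_elim
      case (elim \<sigma>)
      then have "- (v \<bullet> (u - v)) \<le> \<sigma> * (w \<bullet> v - w \<bullet> u)"
        using pos by (subst (asm) pos_divide_le_eq) auto
      then show ?case by (simp add: algebra_simps inner_diff_left inner_diff_right)
    qed
  qed simp
  then have "\<forall>\<^sub>F \<sigma> in at_top. \<forall>u\<in>V. (\<sigma> *\<^sub>R w - v) \<bullet> (u - v) \<le> 0"
    using assms(1) by (simp add: eventually_ball_finite_distrib)
  then show ?thesis
  proof eventually_elim
    case (elim \<sigma>)
    let ?a = "\<sigma> *\<^sub>R w"
    have "convex {x. (?a - v) \<bullet> x \<le> (?a - v) \<bullet> v}" by (rule convex_halfspace_le)
    then have hull: "convex hull V \<subseteq> {x. (?a - v) \<bullet> x \<le> (?a - v) \<bullet> v}"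
      using elim by (intro hull_minimal) (auto simp: inner_diff_right)
    have "dist ?a v \<le> dist ?a z" if "z \<in> convex hull V" for z
    proof -
      have "(?a - v) \<bullet> (z - v) \<le> 0" using hull that by (auto simp: inner_diff_right)
      moreover have "(norm (?a - z))\<^sup>2 = (norm (?a - v))\<^sup>2 + (norm (z - v))\<^sup>2 - 2 * ((?a - v) \<bullet> (z - v))"
        unfolding power2_norm_eq_inner by (simp add: algebra_simps inner_diff_left inner_diff_right inner_commute)
      ultimately have "(norm (?a - v))\<^sup>2 \<le> (norm (?a - z))\<^sup>2"
        using zero_le_power2[of "norm (z - v)"] by linarith
      then show ?thesis by (simp add: dist_norm)
    qed
    then show ?case
      using assms by (intro closest_point_unique[symmetric])
        (auto simp: hull_inc compact_imp_closed finite_imp_compact_convex_hull)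
  qed
qed

section \<open>Angular distribution of radial densities in the plane\<close>

lemma measurable_vector_pair [measurable (raw)]:
  fixes f g :: "'a \<Rightarrow> real"
  assumes "f \<in> borel_measurable M" "g \<in> borel_measurable M"
  shows "(\<lambda>x. vector [f x, g x] :: real^2) \<in> borel_measurable M"
proof -
  have "(\<lambda>x. vector [f x, g x] :: real^2) = (\<lambda>x. f x *\<^sub>R axis 1 1 + g x *\<^sub>R axis 2 1)"
    by (auto simp: vec_eq_iff forall_2 axis_def)
  then show ?thesis using assms by simp
qed

lemma measurable_vector_fst_snd [measurable]:
  "(\<lambda>p::real\<times>real. vector [fst p, snd p] :: real^2) \<in> borel_measurable borel"
  by (intro measurable_vector_pair borel_measurable_continuous_onI continuous_intros)

text \<open>Identifying the plane with a product of two lines makes Fubini's theorem applicable.\<close>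

lemma lborel_plane_eq_distr_pair: "(lborel :: (real^2) measure) = distr lborel borel (\<lambda>(x, y). vector [x, y])"
proof (rule lborel_eqI)
  fix l u :: "real^2" assume le: "\<And>b. b \<in> Basis \<Longrightarrow> l \<bullet> b \<le> u \<bullet> b"
  have B: "(Basis :: (real^2) set) = {axis 1 1, axis 2 1}"
    by (auto simp: Basis_vec_def UNIV_2)
  have ne: "axis 1 1 \<noteq> (axis 2 1 :: real^2)" by (simp add: axis_eq_axis)
  have le': "l $ 1 \<le> u $ 1" "l $ 2 \<le> u $ 2"
    using le[of "axis 1 1"] le[of "axis 2 1"] by (auto simp: B inner_axis)
  have "emeasure (distr lborel borel (\<lambda>(x, y). vector [x, y])) (box l u)
     = emeasure (lborel :: (real \<times> real) measure) ({l $ 1 <..< u $ 1} \<times> {l $ 2 <..< u $ 2})"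
    by (subst emeasure_distr) (auto simp: split_beta' mem_box_cart forall_2 intro!: arg_cong[where f="emeasure _"])
  also have "\<dots> = ennreal ((u $ 1 - l $ 1) * (u $ 2 - l $ 2))"
    using le' unfolding lborel_prod[symmetric]
    by (subst lborel.emeasure_pair_measure_Times) (auto simp: ennreal_mult)
  also have "\<dots> = ennreal (\<Prod>b\<in>Basis. (u - l) \<bullet> b)"
    by (simp add: B ne inner_axis)
  finally show "emeasure (distr lborel borel (\<lambda>(x, y). vector [x, y])) (box l u) = ennreal (\<Prod>b\<in>Basis. (u - l) \<bullet> b)" .
qed simp

text \<open>The slope \<open>- w\<^sub>1 / w\<^sub>2\<close> is the tangent of the angle between \<open>w\<close> and the upward vertical,
  counted positive to the left.\<close>

definition sector :: "real set \<Rightarrow> (real^2) set" where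
  "sector T = {w. 0 < w $ 2 \<and> - (w $ 1 / w $ 2) \<in> T}"

lemma borel_measurable_vec_nth [measurable]: "(\<lambda>w::real^2. w $ i) \<in> borel_measurable borel"
  by (intro borel_measurable_continuous_onI continuous_intros)

lemma sets_sector:
  assumes [measurable]: "T \<in> sets borel"
  shows "sector T \<in> sets borel"
  unfolding sector_def by measurable

text \<open>This is integration in polar coordinates with the slope \<open>t = - w\<^sub>1 / w\<^sub>2\<close> in place of the angle,
  so that two one-dimensional linear substitutions suffice. Putting \<open>w\<^sub>1 = - t w\<^sub>2\<close> at fixed
  \<open>w\<^sub>2\<close> makes the norm \<open>w\<^sub>2 sqrt (1 + t\<^sup>2)\<close>; after exchanging the integrals, the
  substitution \<open>s = w\<^sub>2 sqrt (1 + t\<^sup>2)\<close> separates the radial factor from the angular density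
  \<open>1 / (1 + t\<^sup>2)\<close>.\<close>

lemma sector_integral_radial:
  fixes G :: "real \<Rightarrow> ennreal" and T :: "real set"
  assumes [measurable]: "G \<in> borel_measurable borel" "T \<in> sets borel"
  shows "(\<integral>\<^sup>+w. G (norm w) * indicator (sector T) w \<partial>lborel)
    = (\<integral>\<^sup>+s. ennreal s * G s * indicator {0<..} s \<partial>lborel) * (\<integral>\<^sup>+t. ennreal (1 / (1 + t\<^sup>2)) * indicator T t \<partial>lborel)"
proof -
  let ?I = "indicator {0<..} :: real \<Rightarrow> ennreal"
  let ?K = "\<integral>\<^sup>+s. ennreal s * G s * ?I s \<partial>lborel"
  have nrm: "norm (vector [x, y] :: real^2) = sqrt (x\<^sup>2 + y\<^sup>2)" for x y :: real
    by (simp add: norm_vec_def L2_set_def sum_2)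
  have "(\<integral>\<^sup>+w. G (norm w) * indicator {w::real^2. 0 < w $ 2 \<and> - (w $ 1 / w $ 2) \<in> T} w \<partial>lborel)
    = (\<integral>\<^sup>+p. G (norm (vector [fst p, snd p] :: real^2)) * indicator {w::real^2. 0 < w $ 2 \<and> - (w $ 1 / w $ 2) \<in> T} (vector [fst p, snd p]) \<partial>(lborel \<Otimes>\<^sub>M lborel))"
    by (subst lborel_plane_eq_distr_pair, subst nn_integral_distr) (auto simp: split_beta' lborel_prod)
  also have "\<dots> = (\<integral>\<^sup>+p. G (sqrt ((fst p)\<^sup>2 + (snd p)\<^sup>2)) * (?I (snd p) * indicator T (- (fst p / snd p))) \<partial>(lborel \<Otimes>\<^sub>M lborel))"
    by (intro nn_integral_cong) (auto simp: nrm indicator_def)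
  also have "\<dots> = (\<integral>\<^sup>+y. \<integral>\<^sup>+x. G (sqrt (x\<^sup>2 + y\<^sup>2)) * (?I y * indicator T (- (x / y))) \<partial>lborel \<partial>lborel)"
    by (subst lborel_pair.nn_integral_snd[symmetric]) auto
  also have "\<dots> = (\<integral>\<^sup>+y. \<integral>\<^sup>+t. ennreal y * G (y * sqrt (1 + t\<^sup>2)) * ?I y * indicator T t \<partial>lborel \<partial>lborel)"
  proof (rule nn_integral_cong)
    fix y :: real
    show "(\<integral>\<^sup>+x. G (sqrt (x\<^sup>2 + y\<^sup>2)) * (?I y * indicator T (- (x / y))) \<partial>lborel)
      = (\<integral>\<^sup>+t. ennreal y * G (y * sqrt (1 + t\<^sup>2)) * ?I y * indicator T t \<partial>lborel)"
    proof (cases "0 < y")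
      case True
      have eq: "sqrt ((0 + - y * t)\<^sup>2 + y\<^sup>2) = y * sqrt (1 + t\<^sup>2)" for t
      proof -
        have "(0 + - y * t)\<^sup>2 + y\<^sup>2 = y\<^sup>2 * (1 + t\<^sup>2)" by (simp add: power_mult_distrib algebra_simps)
        then show ?thesis using True by (simp add: real_sqrt_mult)
      qed
      have "(\<integral>\<^sup>+x. G (sqrt (x\<^sup>2 + y\<^sup>2)) * (?I y * indicator T (- (x / y))) \<partial>lborel)
        = \<bar>- y\<bar> * (\<integral>\<^sup>+t. G (y * sqrt (1 + t\<^sup>2)) * (?I y * indicator T t) \<partial>lborel)"
        using True by (subst nn_integral_real_affine[of _ "- y" 0]) (auto simp only: eq, auto)
      then show ?thesis using True
        by (subst (asm) nn_integral_cmult[symmetric]) (auto simp: mult_ac)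
    qed simp
  qed
  also have "\<dots> = (\<integral>\<^sup>+t. \<integral>\<^sup>+y. ennreal y * G (y * sqrt (1 + t\<^sup>2)) * ?I y * indicator T t \<partial>lborel \<partial>lborel)"
    by (rule lborel_pair.Fubini') simp
  also have "\<dots> = (\<integral>\<^sup>+t. ?K * (ennreal (1 / (1 + t\<^sup>2)) * indicator T t) \<partial>lborel)"
  proof (rule nn_integral_cong)
    fix t :: real
    let ?a = "sqrt (1 + t\<^sup>2)"
    have a: "0 < ?a" "?a * ?a = 1 + t\<^sup>2" by (auto simp: add_pos_nonneg)
    have "?K = ennreal ?a * (\<integral>\<^sup>+y. ennreal (?a * y) * G (y * ?a) * ?I y \<partial>lborel)"
      using a(1) by (subst nn_integral_real_affine[of _ "?a" 0])
        (auto simp: mult_ac indicator_def zero_less_mult_iff)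
    also have "\<dots> = ennreal ?a * (\<integral>\<^sup>+y. ennreal ?a * (ennreal y * G (y * ?a) * ?I y) \<partial>lborel)"
      by (simp add: ennreal_mult' mult.assoc)
    also have "\<dots> = ennreal (1 + t\<^sup>2) * (\<integral>\<^sup>+y. ennreal y * G (y * ?a) * ?I y \<partial>lborel)"
      by (subst nn_integral_cmult) (auto simp: a(2) mult.assoc[symmetric] ennreal_mult''[symmetric] simp del: real_sqrt_mult_self)
    finally have K: "?K = ennreal (1 + t\<^sup>2) * (\<integral>\<^sup>+y. ennreal y * G (y * ?a) * ?I y \<partial>lborel)" .
    have "ennreal (1 / (1 + t\<^sup>2)) * ?K = (\<integral>\<^sup>+y. ennreal y * G (y * ?a) * ?I y \<partial>lborel)"
      unfolding K mult.assoc[symmetric]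
      by (subst ennreal_mult''[symmetric]) (auto simp: add_nonneg_eq_0_iff)
    then show "(\<integral>\<^sup>+y. ennreal y * G (y * ?a) * ?I y * indicator T t \<partial>lborel) = ?K * (ennreal (1 / (1 + t\<^sup>2)) * indicator T t)"
      by (subst nn_integral_multc) (auto simp: mult_ac)
  qed
  also have "\<dots> = ?K * (\<integral>\<^sup>+t. ennreal (1 / (1 + t\<^sup>2)) * indicator T t \<partial>lborel)"
    by (rule nn_integral_cmult) auto
  finally show ?thesis unfolding sector_def .
qed

text \<open>Admissibility constrains \<open>q\<close> on \<open>[0, \<infinity>)\<close> alone, hence the absolute value. Restricting the
  measurable function \<open>w \<mapsto> q (norm w)\<close> to the first coordinate axis gives the function of one variable.\<close>

lemma borel_measurable_profile:
  assumes "admissible q"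
  shows "(\<lambda>s::real. q \<bar>s\<bar>) \<in> borel_measurable borel"
proof -
  have "(\<lambda>w::real^2. q (norm w)) \<in> borel_measurable borel"
    using assms borel_measurable_integrable unfolding admissible_def by force
  then have "(\<lambda>s::real. q (norm (vector [s, 0] :: real^2))) \<in> borel_measurable borel"
    by measurable
  moreover have "norm (vector [s, 0] :: real^2) = \<bar>s\<bar>" for s :: real
    by (simp add: norm_vec_def L2_set_def sum_2)
  ultimately show ?thesis by simp
qed

lemma borel_measurable_noise_density:
  assumes "admissible q"
  shows "noise_density q \<in> borel_measurable borel"
  using assms unfolding admissible_def noise_density_def
  by (intro borel_measurable_divide borel_measurable_const) (auto dest: borel_measurable_integrable)

lemma AE_noise_law_off_hyperplane:
  assumes "admissible q" "a \<noteq> 0"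
  shows "AE w in noise_law q. a \<bullet> w \<noteq> 0"
proof -
  have "{x. a \<bullet> x = 0} \<in> null_sets lebesgue"
    using negligible_hyperplane[of a 0] assms by (simp add: negligible_iff_null_sets)
  then have "AE w in lebesgue. a \<bullet> w \<noteq> 0"
    by (rule AE_I') auto
  then have "AE w in lborel. a \<bullet> w \<noteq> 0"
    by (simp add: AE_completion_iff)
  then show ?thesis
    using borel_measurable_noise_density[OF assms(1)] unfolding noise_law_def by (subst AE_density) auto
qed

text \<open>The arctangent integrates the angular density \<open>1 / (1 + t\<^sup>2)\<close>. The constant \<open>K\<close>, which is
  in fact \<open>1 / (2 \<pi>)\<close>, enters the comparison of risks only through its sign.\<close>

lemma sector_probability:
  assumes "admissible q"
  obtains K where "0 < K" "\<And>c. 0 < c \<Longrightarrow> measure (noise_law q) (sector {0..c}) = K * arctan c"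
    "measure (noise_law q) (sector {0..}) = K * (pi / 2)"
proof -
  interpret prob_space "noise_law q" by (rule prob_space_noise_law[OF assms])
  note [measurable] = borel_measurable_profile[OF assms] borel_measurable_noise_density[OF assms]
  define G where "G s = ennreal (q \<bar>s\<bar> / normalizer q)" for s
  have [measurable]: "G \<in> borel_measurable borel"
    unfolding G_def by measurable
  define \<kappa> where "\<kappa> = (\<integral>\<^sup>+s. ennreal s * G s * indicator {0<..} s \<partial>lborel)"
  have sec: "emeasure (noise_law q) (sector T) = \<kappa> * (\<integral>\<^sup>+t. ennreal (1 / (1 + t\<^sup>2)) * indicator T t \<partial>lborel)"
    if [measurable]: "T \<in> sets borel" for T
  proof -
    have "emeasure (noise_law q) (sector T) = (\<integral>\<^sup>+w. G (norm w) * indicator (sector T) w \<partial>lborel)"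
    proof -
      have "G (norm w) = ennreal (noise_density q w)" for w :: "real^2"
        by (simp add: G_def noise_density_def)
      then show ?thesis
        using sets_sector[OF that] unfolding noise_law_def by (subst emeasure_density) auto
    qed
    then show ?thesis
      unfolding \<kappa>_def by (simp add: sector_integral_radial)
  qed
  have der: "DERIV arctan t :> 1 / (1 + t\<^sup>2)" for t
    using DERIV_arctan[of t] by (simp add: divide_inverse)
  have fin: "(\<integral>\<^sup>+t. ennreal (1 / (1 + t\<^sup>2)) * indicator {0..c} t \<partial>lborel) = ennreal (arctan c)" if "0 < c" for c
    using that nn_integral_FTC_Icc[of "\<lambda>t. 1 / (1 + t\<^sup>2)" 0 c arctan] der
    by (auto intro: has_field_derivative_at_within simp: add_nonneg_nonneg)
  have inf: "(\<integral>\<^sup>+t. ennreal (1 / (1 + t\<^sup>2)) * indicator {0..} t \<partial>lborel) = ennreal (pi / 2)"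
    using nn_integral_FTC_atLeast[of "\<lambda>t. 1 / (1 + t\<^sup>2)" 0 arctan "pi / 2"] der tendsto_arctan_at_top
    by (auto simp: add_nonneg_nonneg)
  have "\<kappa> \<noteq> \<infinity>"
  proof
    assume "\<kappa> = \<infinity>"
    then have "emeasure (noise_law q) (sector {0..}) = \<infinity>"
      by (simp add: sec inf ennreal_top_mult)
    then show False using emeasure_finite by auto
  qed
  then obtain K where K: "0 \<le> K" "\<kappa> = ennreal K"
    by (cases \<kappa>) auto
  have "\<kappa> \<noteq> 0"
  proof
    assume "\<kappa> = 0"
    then have "AE s in lborel. ennreal s * G s * indicator {0<..} s = 0"
      unfolding \<kappa>_def by (subst (asm) nn_integral_0_iff_AE) auto
    moreover have "0 < G s" for s
      using assms by (auto simp: G_def admissible_def)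
    ultimately have "AE s in lborel. s \<notin> {0<..<1::real}"
      by (auto elim!: eventually_mono simp: indicator_def split: if_splits)
         (metis less_numeral_extra(3))
    then have "emeasure lborel {0<..<1::real} = 0"
      by (subst (asm) AE_iff_null_sets[symmetric]) auto
    then show False by simp
  qed
  then have "0 < K" using K by (auto simp: less_le)
  moreover have "measure (noise_law q) (sector {0..c}) = K * arctan c" if "0 < c" for c
    using that K by (simp add: measure_def sec fin ennreal_mult''[symmetric])
  moreover have "measure (noise_law q) (sector {0..}) = K * (pi / 2)"
    using K by (simp add: measure_def sec inf ennreal_mult''[symmetric])
  ultimately show thesis by (rule that)
qed

section \<open>Limit of the risk difference\<close>

lemma bounded_projection_error:
  assumes "compact \<Theta>" "\<Theta> \<noteq> {}" "0 < \<eta>"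
  obtains B where "\<And>y. norm (1 / \<eta> * norm (closest_point \<Theta> y) powr \<eta>) \<le> B"
proof -
  obtain b where b: "\<And>x. x \<in> \<Theta> \<Longrightarrow> norm x \<le> b"
    using compact_imp_bounded[OF assms(1)] unfolding bounded_iff by blast
  have "norm (closest_point \<Theta> y) powr \<eta> \<le> b powr \<eta>" for y
    using assms b closest_point_exists(1)[of \<Theta> y]
    by (intro powr_mono2) (auto simp: compact_imp_closed)
  then show thesis
    using assms by (intro that[of "1 / \<eta> * b powr \<eta>"]) (auto simp: divide_right_mono)
qed

text \<open>Segment and triangle select different vertices only in the quadrant that appears here as a
  sector: \<open>sector {0..}\<close> is the quadrant of the directions that select \<open>v\<^sub>3\<close> in the
  triangle, and \<open>sector {0..c}\<close> its part that selects \<open>v\<^sub>2\<close> in the segment. Boundary directions, in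
  which the selected vertex is not unique, form a null set.\<close>

lemma risk_gap_tendsto:
  assumes q: "admissible q" and "0 < c" "0 < \<eta>"
  shows "((\<lambda>\<sigma>. radial_risk q \<eta> \<sigma> vtx1 (Theta_S c) - radial_risk q \<eta> \<sigma> vtx1 (Theta_L c)) \<longlongrightarrow>
    1 / \<eta> * (sqrt (1 + (1 / c)\<^sup>2) powr \<eta> * measure (noise_law q) (sector {0..c})
      - measure (noise_law q) (sector {0..}))) at_top"
proof -
  interpret prob_space "noise_law q" by (rule prob_space_noise_law[OF q])
  define r where "r = sqrt (1 + (1 / c)\<^sup>2) powr \<eta>"
  define err where "err \<Theta> \<sigma> w = 1 / \<eta> * norm (closest_point \<Theta> (\<sigma> *\<^sub>R w)) powr \<eta>" for \<Theta> \<sigma> and w :: "real^2"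
  define gap where "gap w = 1 / \<eta> * (r * indicator (sector {0..c}) w - indicator (sector {0..}) w)" for w
  have sets_eq [simp]: "sets (noise_law q) = sets borel" "space (noise_law q) = UNIV"
    by (auto simp: noise_law_def)
  have [measurable_cong]: "sets (noise_law q) = sets borel" by simp
  have [measurable]: "sector {0..c} \<in> sets borel" "sector {0..} \<in> sets borel"
    by (auto intro: sets_sector)
  have nrm: "norm (vtx2 c) = sqrt (1 + (1 / c)\<^sup>2)" "norm vtx3 = 1"
    by (auto simp: vtx2_def vtx3_def norm_vec_def L2_set_def sum_2)
  have inn: "w \<bullet> vtx2 c = w $ 1 / c + w $ 2" "w \<bullet> vtx3 = w $ 2" "w \<bullet> vtx1 = 0" for w :: "real^2"
    by (auto simp: vtx1_def vtx2_def vtx3_def inner_vec_def sum_2)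
  have meas [measurable]: "err \<Theta> \<sigma> \<in> borel_measurable borel" if "\<Theta> \<in> {Theta_S c, Theta_L c}" for \<Theta> \<sigma>
  proof -
    have [measurable]: "closest_point \<Theta> \<in> borel_measurable borel"
      using constraint_sets[OF that]
      by (intro borel_measurable_continuous_onI continuous_on_closest_point) (auto simp: compact_imp_closed)
    show ?thesis unfolding err_def by measurable
  qed
  obtain BS where BS: "\<And>\<sigma> w. norm (err (Theta_S c) \<sigma> w) \<le> BS"
    using bounded_projection_error[of "Theta_S c" \<eta>] constraint_sets[of "Theta_S c" c] assms unfolding err_def by (metis insertI1)
  obtain BL where BL: "\<And>\<sigma> w. norm (err (Theta_L c) \<sigma> w) \<le> BL"
    using bounded_projection_error[of "Theta_L c" \<eta>] constraint_sets[of "Theta_L c" c] assms unfolding err_def by (metis insertI1 insert_commute)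
  have int: "integrable (noise_law q) (err (Theta_S c) \<sigma>)" "integrable (noise_law q) (err (Theta_L c) \<sigma>)" for \<sigma>
    using meas BS BL
    by (auto intro: integrable_const_bound[where B = BS] integrable_const_bound[where B = BL])
  have risk: "radial_risk q \<eta> \<sigma> vtx1 (Theta_S c) - radial_risk q \<eta> \<sigma> vtx1 (Theta_L c)
    = (\<integral>w. err (Theta_S c) \<sigma> w - err (Theta_L c) \<sigma> w \<partial>noise_law q)" for \<sigma>
  proof -
    have "radial_risk q \<eta> \<sigma> vtx1 \<Theta> = (\<integral>w. err \<Theta> \<sigma> w \<partial>noise_law q)" for \<Theta>
      by (simp only: radial_risk_def vtx1_zero err_def add_0 diff_zero)
    then show ?thesis
      using int by simp
  qed
  have lim: "((\<lambda>\<sigma>. err (Theta_S c) \<sigma> w - err (Theta_L c) \<sigma> w) \<longlongrightarrow> gap w) at_top"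
    if ne: "w \<bullet> vtx2 c \<noteq> 0" "w $ 1 \<noteq> 0" "w $ 2 \<noteq> 0" for w
  proof -
    \<comment> \<open>The vertices of segment and triangle at which the inner product with \<open>w\<close> is maximal.\<close>
    define s where "s = (if 0 < w \<bullet> vtx2 c then vtx2 c else vtx1)"
    define l where "l = (if w $ 1 < 0 then if 0 < w $ 2 then vtx3 else vtx1 else
      if 0 < w \<bullet> vtx2 c then vtx2 c else vtx1)"
    have S: "\<forall>\<^sub>F \<sigma> in at_top. closest_point (Theta_S c) (\<sigma> *\<^sub>R w) = s"
      unfolding Theta_S_def using ne
      by (intro closest_point_hull_eventually_vertex) (auto simp: s_def inn split: if_splits)
    have L: "\<forall>\<^sub>F \<sigma> in at_top. closest_point (Theta_L c) (\<sigma> *\<^sub>R w) = l"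
      unfolding Theta_L_def
    proof (rule closest_point_hull_eventually_vertex)
      fix u assume "u \<in> {vtx1, vtx2 c, vtx3}" "u \<noteq> l"
      moreover have "0 < w $ 1 / c \<longleftrightarrow> 0 < w $ 1" "w $ 1 / c < 0 \<longleftrightarrow> w $ 1 < 0"
        using assms by (auto simp: zero_less_divide_iff divide_less_0_iff)
      ultimately show "w \<bullet> u < w \<bullet> l"
        using ne by (auto simp: l_def inn split: if_splits)
    qed (auto simp: l_def)
    have "1 / \<eta> * norm s powr \<eta> - 1 / \<eta> * norm l powr \<eta> = gap w"
    proof -
      have "w \<in> sector {0..} \<longleftrightarrow> w $ 1 < 0 \<and> 0 < w $ 2"
        using ne by (auto simp: sector_def divide_le_0_iff)
      moreover have "w \<in> sector {0..c} \<longleftrightarrow> w $ 1 < 0 \<and> 0 < w $ 2 \<and> 0 < w \<bullet> vtx2 c"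
        using ne assms by (auto simp: sector_def inn divide_le_0_iff field_simps)
      moreover have "0 < w $ 2" if "w $ 1 < 0" "0 < w \<bullet> vtx2 c"
        using that assms divide_neg_pos[of "w $ 1" c] by (auto simp: inn)
      ultimately show ?thesis
        by (auto simp: gap_def s_def l_def r_def nrm vtx1_zero indicator_def algebra_simps)
    qed
    moreover have "\<forall>\<^sub>F \<sigma> in at_top. err (Theta_S c) \<sigma> w - err (Theta_L c) \<sigma> w = 1 / \<eta> * norm s powr \<eta> - 1 / \<eta> * norm l powr \<eta>"
      using S L by eventually_elim (simp add: err_def)
    ultimately show ?thesis by (simp add: tendsto_eventually)
  qed
  have AE: "AE w in noise_law q. w \<bullet> vtx2 c \<noteq> 0 \<and> w $ 1 \<noteq> 0 \<and> w $ 2 \<noteq> 0"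
  proof -
    have "vtx2 c \<noteq> 0" "axis 1 1 \<noteq> (0::real^2)" "axis 2 1 \<noteq> (0::real^2)"
      using nrm(1) by (auto simp: axis_eq_0_iff vtx2_def vec_eq_iff forall_2)
    from this[THEN AE_noise_law_off_hyperplane[OF q]] show ?thesis
      by eventually_elim (simp add: inner_axis' inner_commute[of _ "vtx2 c"])
  qed
  have "((\<lambda>\<sigma>. \<integral>w. err (Theta_S c) \<sigma> w - err (Theta_L c) \<sigma> w \<partial>noise_law q) \<longlongrightarrow> (\<integral>w. gap w \<partial>noise_law q)) at_top"
  proof (rule integral_dominated_convergence_at_top[where w = "\<lambda>_. BS + BL"])
    show "AE w in noise_law q. ((\<lambda>\<sigma>. err (Theta_S c) \<sigma> w - err (Theta_L c) \<sigma> w) \<longlongrightarrow> gap w) at_top"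
      using AE by eventually_elim (use lim in auto)
    have "norm (err (Theta_S c) \<sigma> w - err (Theta_L c) \<sigma> w) \<le> BS + BL" for \<sigma> w
      using norm_triangle_ineq4[of "err (Theta_S c) \<sigma> w" "err (Theta_L c) \<sigma> w"] BS[of \<sigma> w] BL[of \<sigma> w] by linarith
    then show "\<forall>\<^sub>F \<sigma> in at_top. AE w in noise_law q. norm (err (Theta_S c) \<sigma> w - err (Theta_L c) \<sigma> w) \<le> BS + BL"
      by simp
    show "gap \<in> borel_measurable (noise_law q)"
      unfolding gap_def by measurable
    show "(\<lambda>w. err (Theta_S c) \<sigma> w - err (Theta_L c) \<sigma> w) \<in> borel_measurable (noise_law q)" for \<sigma>
      using meas by simp
  qed simp
  also have "(\<integral>w. gap w \<partial>noise_law q) = 1 / \<eta> * (r * prob (sector {0..c}) - prob (sector {0..}))"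
  proof -
    have "integrable (noise_law q) (indicat_real (sector {0..c}))" "integrable (noise_law q) (indicat_real (sector {0..}))"
      by (auto intro!: integrable_real_indicator simp: emeasure_finite less_top[symmetric])
    then show ?thesis
      unfolding gap_def by simp
  qed
  finally show ?thesis by (simp only: risk r_def)
qed

lemma eventually_smaller_set_riskier:
  assumes "admissible q" "0 < c" "0 < \<eta>" and "pi / 2 < arctan c * sqrt (1 + (1 / c)\<^sup>2) powr \<eta>"
  shows "\<exists>\<sigma>\<^sub>1>0. \<forall>\<sigma>\<ge>\<sigma>\<^sub>1. radial_risk q \<eta> \<sigma> vtx1 (Theta_S c) > radial_risk q \<eta> \<sigma> vtx1 (Theta_L c)"
proof -
  obtain K where K: "0 < K" "measure (noise_law q) (sector {0..c}) = K * arctan c"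
    "measure (noise_law q) (sector {0..}) = K * (pi / 2)"
    using sector_probability[OF assms(1)] assms(2) by metis
  have "0 < 1 / \<eta> * (K * (arctan c * sqrt (1 + (1 / c)\<^sup>2) powr \<eta> - pi / 2))"
    using K(1) assms by simp
  also have "\<dots> = 1 / \<eta> * (sqrt (1 + (1 / c)\<^sup>2) powr \<eta> * measure (noise_law q) (sector {0..c})
      - measure (noise_law q) (sector {0..}))"
    by (simp add: K algebra_simps)
  finally have "\<forall>\<^sub>F \<sigma> in at_top. 0 < radial_risk q \<eta> \<sigma> vtx1 (Theta_S c) - radial_risk q \<eta> \<sigma> vtx1 (Theta_L c)"
    using order_tendstoD(1)[OF risk_gap_tendsto[OF assms(1-3)]] by blast
  then obtain s where s: "\<And>\<sigma>. s \<le> \<sigma> \<Longrightarrow> radial_risk q \<eta> \<sigma> vtx1 (Theta_L c) < radial_risk q \<eta> \<sigma> vtx1 (Theta_S c)"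
    by (auto simp: eventually_at_top_linorder)
  then show ?thesis by (intro exI[of _ "max s 1"]) auto
qed

section \<open>Length of the far vertex against the opening angle\<close>

text \<open>The cosine is strictly concave on \<open>[0, \<pi>/2]\<close> and lies strictly above its chord.\<close>

lemma two_over_pi_less_cos:
  fixes x :: real
  assumes "0 < x" "x < pi / 2"
  shows "1 - 2 * x / pi < cos x"
proof -
  define f where "f = (\<lambda>t. cos t - 1 + 2 * t / pi)"
  have der: "DERIV f t :> - sin t + 2 / pi" for t
    unfolding f_def by (auto intro!: derivative_eq_intros)
  obtain \<xi> where \<xi>: "0 < \<xi>" "\<xi> < x" "f x - f 0 = (x - 0) * (- sin \<xi> + 2 / pi)"
    using MVT2[OF assms(1), of f "\<lambda>t. - sin t + 2 / pi"] der by blast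
  obtain \<zeta> where \<zeta>: "x < \<zeta>" "\<zeta> < pi / 2" "f (pi / 2) - f x = (pi / 2 - x) * (- sin \<zeta> + 2 / pi)"
    using MVT2[OF assms(2), of f "\<lambda>t. - sin t + 2 / pi"] der by blast
  have ends: "f 0 = 0" "f (pi / 2) = 0"
    by (auto simp: f_def)
  \<comment> \<open>The slopes of the two chords of \<open>f\<close> meeting at \<open>x\<close> are compared.\<close>
  have "sin \<xi> < sin \<zeta>"
    using \<xi> \<zeta> by (intro sin_monotone_2pi) auto
  moreover have "f x / x = - sin \<xi> + 2 / pi"
    using \<xi>(3) ends assms by (simp add: field_simps)
  moreover have "- f x / (pi / 2 - x) = - sin \<zeta> + 2 / pi"
    using \<zeta>(3) ends assms by (simp add: field_simps)
  ultimately have "- f x / (pi / 2 - x) < f x / x" by linarith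
  then have "0 < f x / x + f x / (pi / 2 - x)" by simp
  also have "\<dots> = f x * (1 / x + 1 / (pi / 2 - x))" by (simp add: algebra_simps)
  finally have "0 < f x * (1 / x + 1 / (pi / 2 - x))" .
  moreover have "0 < 1 / x + 1 / (pi / 2 - x)"
    using assms by (intro add_pos_pos) auto
  ultimately have "0 < f x" by (simp add: zero_less_mult_iff)
  then show ?thesis by (simp add: f_def)
qed

text \<open>With \<open>\<phi> = arctan c\<close> the far vertex has norm \<open>x = 1 / sin \<phi>\<close>. From \<open>sin \<phi> \<le> \<phi>\<close> one factor
  \<open>x\<close> already compensates \<open>\<phi>\<close>, and the remaining power \<open>\<eta> - 1\<close> of \<open>x > 1 / c\<close> exceeds
  \<open>\<pi> / 2\<close> by the choice of the bound on \<open>c\<close>.\<close>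

lemma length_outweighs_angle_small_slope:
  fixes c \<eta> :: real
  assumes "0 < c" and "1 < \<eta>" "c < (2 / pi) powr (1 / (\<eta> - 1))"
  shows "pi / 2 < arctan c * (sqrt (1 + (1 / c)\<^sup>2)) powr \<eta>"
proof -
  define x where "x = sqrt (1 + (1 / c)\<^sup>2)"
  have "1 + (1 / c)\<^sup>2 = (1 + c\<^sup>2) / c\<^sup>2"
    using assms(1) by (simp add: field_simps)
  then have x: "x = sqrt (1 + c\<^sup>2) / c"
    using assms(1) by (simp add: x_def real_sqrt_divide)
  have "1 / c < x"
    using assms(1) unfolding x_def by (intro real_less_rsqrt) simp
  have "c powr (\<eta> - 1) < ((2 / pi) powr (1 / (\<eta> - 1))) powr (\<eta> - 1)"
    using assms by (intro powr_less_mono2) auto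
  also have "\<dots> = 2 / pi"
    using assms by (simp add: powr_powr)
  finally have "pi / 2 < (1 / c) powr (\<eta> - 1)"
    using assms(1) by (simp add: powr_divide field_simps)
  also have "\<dots> \<le> x powr (\<eta> - 1)"
    using assms \<open>1 / c < x\<close> by (intro powr_mono2) auto
  finally have 1: "pi / 2 < x powr (\<eta> - 1)" .
  have "1 / x \<le> arctan c"
    using sin_x_le_x[of "arctan c"] assms(1) by (simp add: sin_arctan x)
  moreover have "0 < x" using \<open>1 / c < x\<close> assms(1) by (meson less_trans zero_less_divide_1_iff)
  ultimately have "1 \<le> arctan c * x"
    by (simp add: field_simps)
  then have "1 * (pi / 2) < (arctan c * x) * x powr (\<eta> - 1)"
    using 1 by (intro mult_le_less_imp_less) auto
  also have "\<dots> = arctan c * x powr \<eta>"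
    using \<open>0 < x\<close> by (simp add: powr_diff)
  finally show ?thesis by (simp add: x_def)
qed

text \<open>Since the norm of the far vertex is at least \<open>1\<close>, the exponent may be lowered to \<open>2\<close>; what
  remains is \<open>(sin \<phi>)\<^sup>2 < 2 \<phi> / \<pi>\<close> for \<open>\<phi> = arctan c < \<pi> / 4\<close>, which the double-angle formula reduces to
  the chord bound for the cosine at \<open>2 \<phi>\<close>.\<close>

lemma length_outweighs_angle_quadratic:
  fixes c \<eta> :: real
  assumes "0 < c" "c < 1" "2 \<le> \<eta>"
  shows "pi / 2 < arctan c * (sqrt (1 + (1 / c)\<^sup>2)) powr \<eta>"
proof -
  define x where "x = sqrt (1 + (1 / c)\<^sup>2)"
  define \<phi> where "\<phi> = arctan c"
  have \<phi>: "0 < \<phi>" "\<phi> < pi / 4"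
    using assms arctan_less_iff[of c 1] by (auto simp: \<phi>_def arctan_one)
  have x2: "x\<^sup>2 = 1 + (1 / c)\<^sup>2" "1 \<le> x" by (auto simp: x_def)
  have "1 - 2 * (2 * \<phi>) / pi < cos (2 * \<phi>)"
    using \<phi> by (intro two_over_pi_less_cos) auto
  then have "(sin \<phi>)\<^sup>2 < 2 * \<phi> / pi"
    by (simp add: cos_double_sin)
  moreover have "(sin \<phi>)\<^sup>2 = 1 / x\<^sup>2"
  proof -
    have "0 < 1 + c\<^sup>2" by (simp add: add_pos_nonneg)
    then have "x\<^sup>2 = (1 + c\<^sup>2) / c\<^sup>2" "(sin \<phi>)\<^sup>2 = c\<^sup>2 / (1 + c\<^sup>2)"
      using assms by (auto simp: x2 \<phi>_def sin_arctan power_divide field_simps)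
    then show ?thesis by simp
  qed
  ultimately have "1 / x\<^sup>2 < 2 * \<phi> / pi" by simp
  then have "pi / 2 < \<phi> * x\<^sup>2"
    using x2(2) by (simp add: field_simps)
  also have "\<dots> = \<phi> * x powr 2"
    using x2 by simp
  also have "\<dots> \<le> \<phi> * x powr \<eta>"
    using x2 \<phi> assms by (intro mult_left_mono powr_mono) auto
  finally show ?thesis by (simp add: x_def \<phi>_def)
qed

theorem theorem2p12:
  shows "(\<forall>c q \<sigma> y. 0 < c \<longrightarrow> admissible q \<longrightarrow> 0 < \<sigma> \<longrightarrow>
            (\<forall>\<Theta>\<in>{Theta_S c, Theta_L c}. \<forall>\<theta>.
               (is_constrained_mle q \<sigma> \<Theta> y \<theta> \<longleftrightarrow> \<theta> = closest_point \<Theta> y) \<and>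
               (is_constrained_lse \<Theta> y \<theta> \<longleftrightarrow> \<theta> = closest_point \<Theta> y)))
       \<and> (\<forall>\<eta>>1. \<exists>c\<^sub>\<eta>>0. \<forall>q c. admissible q \<longrightarrow> 0 < c \<longrightarrow> c < c\<^sub>\<eta> \<longrightarrow>
            (\<exists>\<sigma>\<^sub>1>0. \<forall>\<sigma>\<ge>\<sigma>\<^sub>1.
               radial_risk q \<eta> \<sigma> vtx1 (Theta_S c) > radial_risk q \<eta> \<sigma> vtx1 (Theta_L c)))
       \<and> (\<forall>\<eta>\<ge>2. \<forall>q c. admissible q \<longrightarrow> 0 < c \<longrightarrow> c < 1 \<longrightarrow>
            (\<exists>\<sigma>\<^sub>1>0. \<forall>\<sigma>\<ge>\<sigma>\<^sub>1.
               radial_risk q \<eta> \<sigma> vtx1 (Theta_S c) > radial_risk q \<eta> \<sigma> vtx1 (Theta_L c)))"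
proof (intro conjI allI impI)
  fix c \<sigma> :: real and q and y :: "real^2"
  assume "0 < c" "admissible q" "0 < \<sigma>"
  then show "\<forall>\<Theta>\<in>{Theta_S c, Theta_L c}. \<forall>\<theta>.
      (is_constrained_mle q \<sigma> \<Theta> y \<theta> \<longleftrightarrow> \<theta> = closest_point \<Theta> y) \<and>
      (is_constrained_lse \<Theta> y \<theta> \<longleftrightarrow> \<theta> = closest_point \<Theta> y)"
    by (intro ballI allI conjI mle_iff_projection lse_iff_projection constraint_sets)
next
  fix \<eta> :: real
  assume "1 < \<eta>"
  then show "\<exists>c\<^sub>\<eta>>0. \<forall>q c. admissible q \<longrightarrow> 0 < c \<longrightarrow> c < c\<^sub>\<eta> \<longrightarrow>
      (\<exists>\<sigma>\<^sub>1>0. \<forall>\<sigma>\<ge>\<sigma>\<^sub>1.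
         radial_risk q \<eta> \<sigma> vtx1 (Theta_S c) > radial_risk q \<eta> \<sigma> vtx1 (Theta_L c))"
    by (intro exI[of _ "(2 / pi) powr (1 / (\<eta> - 1))"] conjI allI impI
        eventually_smaller_set_riskier length_outweighs_angle_small_slope) simp_all
next
  fix \<eta> c :: real and q
  assume "2 \<le> \<eta>" "admissible q" "0 < c" "c < 1"
  then show "\<exists>\<sigma>\<^sub>1>0. \<forall>\<sigma>\<ge>\<sigma>\<^sub>1.
      radial_risk q \<eta> \<sigma> vtx1 (Theta_S c) > radial_risk q \<eta> \<sigma> vtx1 (Theta_L c)"
    by (intro eventually_smaller_set_riskier length_outweighs_angle_quadratic) simp_all
qed

end
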